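(* Let $M$ be a metric space, let $f\colon M\to M$ be a Lipschitz map, let $x\in M$, and set $e:=f(x)$. Then $\mathrm{Orb}(x,f)$ is dense in $M$ if and only if $\delta(x)\in\mathcal F(M,e)$ is a cyclic vector for $T_{f,e}\colon\mathcal F(M,e)\to\mathcal F(M,e)$.
   Context: $\mathbb K$ denotes $\mathbb R$ or $\mathbb C$. For a metric space $M$ and $e\in M$, $\mathrm{Lip}_0(M,e)$ is the Banach space of Lipschitz functions $\varphi\colon M\to\mathbb K$ with $\varphi(e)=0$, normed by the best Lipschitz constant. For $x\in M$, $\delta(x)=\delta_e(x)\in \mathrm{Lip}_0(M,e)^*$ is the evaluation functional $\varphi\mapsto\varphi(x)$. The Lipschitz-free space with basepoint $e$ is $\mathcal F(M,e):=\overline{\mathrm{span}}\{\delta(x):x\in M\}\subset \mathrm{Lip}_0(M,e)^*$ (norm closure). For a Lipschitz map $f\colon M\to M$ (not assumed to fix $e$), $T_{f,e}\colon\mathcal F(M,e)\to\mathcal F(M,e)$ is the unique bounded linear operator with $T_{f,e}(\delta(x))=\delta(f(x))-\delta(f(e))$ for all $x\in M$. The orbit of a point $x$ under a self-map $f$ is $\mathrm{Orb}(x,f)=\{f^n(x):n\in\mathbb N\cup\{0\}\}$. A vector $v\in X$ is cyclic for a bounded operator $T\colon X\to X$ if $\overline{\mathrm{span}}\,\mathrm{Orb}(v,T)=X$. *)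

theory Defs
  imports "HOL-Analysis.Analysis" "HOL-Library.Function_Algebras"
begin

text \<open>
  The space \<open>Lip\<^sub>0(M,e)\<close> depends on the point \<open>e\<close>, so it and the spaces built from it are
  represented as carrier sets. Their vectors are functions with values in the scalar field \<open>'k\<close>
  (to be instantiated to \<^typ>\<open>real\<close> and \<^typ>\<open>complex\<close>), with pointwise operations.
\<close>

definition fscale :: "'k::times \<Rightarrow> ('i \<Rightarrow> 'k) \<Rightarrow> 'i \<Rightarrow> 'k"
  where "fscale c u = (\<lambda>i. c * u i)"

definition bounded_operator ::
    "('k \<Rightarrow> 'v \<Rightarrow> 'v) \<Rightarrow> 'v set \<Rightarrow> ('v \<Rightarrow> real) \<Rightarrow> ('k \<Rightarrow> 'w \<Rightarrow> 'w) \<Rightarrow> 'w set \<Rightarrow> ('w \<Rightarrow> real) \<Rightarrow>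
      ('v::plus \<Rightarrow> 'w::plus) \<Rightarrow> bool"
  where "bounded_operator sX X NX sY Y NY T \<longleftrightarrow>
    (\<forall>u\<in>X. T u \<in> Y) \<and>
    (\<forall>u\<in>X. \<forall>v\<in>X. T (u + v) = T u + T v) \<and>
    (\<forall>c. \<forall>u\<in>X. T (sX c u) = sY c (T u)) \<and>
    (\<exists>B. \<forall>u\<in>X. NY (T u) \<le> B * NX u)"

definition norm_closure :: "'v set \<Rightarrow> ('v \<Rightarrow> real) \<Rightarrow> 'v set \<Rightarrow> 'v::minus set"
  where "norm_closure X N S = {u \<in> X. \<forall>\<epsilon>>0. \<exists>v\<in>S. N (u - v) < \<epsilon>}"

definition Orb :: "'v \<Rightarrow> ('v \<Rightarrow> 'v) \<Rightarrow> 'v set"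
  where "Orb x f = {(f ^^ n) x | n. True}"

definition cyclic_vector ::
    "('k::comm_ring_1 \<Rightarrow> 'v \<Rightarrow> 'v) \<Rightarrow> 'v set \<Rightarrow> ('v \<Rightarrow> real) \<Rightarrow> ('v::ab_group_add \<Rightarrow> 'v) \<Rightarrow> 'v \<Rightarrow> bool"
  where "cyclic_vector s X N T v \<longleftrightarrow>
    v \<in> X \<and> norm_closure X N (module.span s (Orb v T)) = X"

definition Lip0 :: "'a::metric_space \<Rightarrow> ('a \<Rightarrow> 'k::real_normed_field) set"
  where "Lip0 e = {\<phi>. (\<exists>C. C-lipschitz_on UNIV \<phi>) \<and> \<phi> e = 0}"

definition lip_norm :: "('a::metric_space \<Rightarrow> 'k::real_normed_field) \<Rightarrow> real"
  where "lip_norm \<phi> = Inf {C. C-lipschitz_on UNIV \<phi>}"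

text \<open>
  Functionals on \<^term>\<open>Lip0 e\<close> are made total by the value 0 outside \<^term>\<open>Lip0 e\<close>, so that two of
  them are equal as HOL functions iff they agree on \<^term>\<open>Lip0 e\<close>.
\<close>

definition Lip0_dual :: "'a::metric_space \<Rightarrow> (('a \<Rightarrow> 'k::real_normed_field) \<Rightarrow> 'k) set"
  where "Lip0_dual e = {F. bounded_operator fscale (Lip0 e) lip_norm (*) UNIV norm F \<and>
    (\<forall>\<phi>. \<phi> \<notin> Lip0 e \<longrightarrow> F \<phi> = 0)}"

definition dual_norm :: "'a::metric_space \<Rightarrow> (('a \<Rightarrow> 'k::real_normed_field) \<Rightarrow> 'k) \<Rightarrow> real"
  where "dual_norm e F = (SUP \<phi>\<in>{\<phi> \<in> Lip0 e. lip_norm \<phi> \<le> 1}. norm (F \<phi>))"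

definition delta :: "'a::metric_space \<Rightarrow> 'a \<Rightarrow> ('a \<Rightarrow> 'k::real_normed_field) \<Rightarrow> 'k"
  where "delta e x = (\<lambda>\<phi>. if \<phi> \<in> Lip0 e then \<phi> x else 0)"

definition free_space :: "'a::metric_space \<Rightarrow> (('a \<Rightarrow> 'k::real_normed_field) \<Rightarrow> 'k) set"
  where "free_space e = norm_closure (Lip0_dual e) (dual_norm e) (module.span fscale (range (delta e)))"

text \<open>
  Extensionality off \<^term>\<open>free_space e\<close> makes the operator unique as a HOL function; that exactly one
  such operator exists for Lipschitz \<open>f\<close> is proved in \<open>free_op_ex1\<close> below.
\<close>

definition is_free_op :: "('a::metric_space \<Rightarrow> 'a) \<Rightarrow> 'a \<Rightarrow>
    ((('a \<Rightarrow> 'k::real_normed_field) \<Rightarrow> 'k) \<Rightarrow> (('a \<Rightarrow> 'k) \<Rightarrow> 'k)) \<Rightarrow> bool"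
  where "is_free_op f e T \<longleftrightarrow>
    T \<in> extensional (free_space e) \<and>
    bounded_operator fscale (free_space e) (dual_norm e) fscale (free_space e) (dual_norm e) T \<and>
    (\<forall>x. T (delta e x) = delta e (f x) - delta e (f e))"

definition free_op :: "('a::metric_space \<Rightarrow> 'a) \<Rightarrow> 'a \<Rightarrow>
    (('a \<Rightarrow> 'k::real_normed_field) \<Rightarrow> 'k) \<Rightarrow> (('a \<Rightarrow> 'k) \<Rightarrow> 'k)"
  where "free_op f e = (THE T. is_free_op f e T)"


subsection \<open>Well-definedness of the operator\<close>

lemma module_fscale: "module (fscale :: 'k::comm_ring_1 \<Rightarrow> ('i \<Rightarrow> 'k) \<Rightarrow> 'i \<Rightarrow> 'k)"
  by unfold_locales (auto simp: fscale_def fun_eq_iff algebra_simps)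

interpretation fs: module "fscale :: 'k::comm_ring_1 \<Rightarrow> ('i \<Rightarrow> 'k) \<Rightarrow> 'i \<Rightarrow> 'k"
  by (rule module_fscale)

lemma fscale_minus1: "(- u) = fscale (- 1) (u :: 'i \<Rightarrow> 'k::comm_ring_1)"
  by (auto simp: fscale_def fun_eq_iff)

lemma lip_norm_lipschitz:
  fixes \<phi> :: "'a::metric_space \<Rightarrow> 'k::real_normed_field"
  assumes "C-lipschitz_on UNIV \<phi>"
  shows "(lip_norm \<phi>)-lipschitz_on UNIV \<phi>"
proof (rule lipschitz_onI)
  let ?S = "{C. C-lipschitz_on UNIV \<phi>}"
  have ne: "?S \<noteq> {}" using assms by auto
  show "0 \<le> lip_norm \<phi>"
    unfolding lip_norm_def by (rule cInf_greatest[OF ne]) (auto simp: lipschitz_on_def)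
  fix x y :: 'a
  show "dist (\<phi> x) (\<phi> y) \<le> lip_norm \<phi> * dist x y"
  proof (cases "x = y")
    case False
    then have d: "dist x y > 0" by simp
    have "dist (\<phi> x) (\<phi> y) / dist x y \<le> lip_norm \<phi>"
      unfolding lip_norm_def
      by (rule cInf_greatest[OF ne]) (use d in \<open>auto simp: lipschitz_on_def field_simps\<close>)
    then show ?thesis using d by (simp add: field_simps)
  qed simp
qed

lemma lip_norm_le:
  fixes \<phi> :: "'a::metric_space \<Rightarrow> 'k::real_normed_field"
  assumes "C-lipschitz_on UNIV \<phi>"
  shows "lip_norm \<phi> \<le> C"
  unfolding lip_norm_def
  by (rule cInf_lower) (use assms in \<open>auto simp: lipschitz_on_def intro: bdd_belowI\<close>)

lemma lip_norm_nonneg: "\<phi> \<in> Lip0 e \<Longrightarrow> 0 \<le> lip_norm \<phi>"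
  using lip_norm_lipschitz lipschitz_on_nonneg unfolding Lip0_def by blast

lemma Lip0_dist: "\<phi> \<in> Lip0 e \<Longrightarrow> norm (\<phi> x - \<phi> y) \<le> lip_norm \<phi> * dist x y"
  using lip_norm_lipschitz unfolding Lip0_def lipschitz_on_def dist_norm by blast

lemma Lip0I:
  fixes \<phi> :: "'a::metric_space \<Rightarrow> 'k::real_normed_field"
  assumes "\<phi> e = 0" "0 \<le> C" "\<And>x y. norm (\<phi> x - \<phi> y) \<le> C * dist x y"
  shows "\<phi> \<in> Lip0 e" "lip_norm \<phi> \<le> C"
proof -
  have "C-lipschitz_on UNIV \<phi>" using assms by (auto simp: lipschitz_on_def dist_norm)
  then show "\<phi> \<in> Lip0 e" "lip_norm \<phi> \<le> C" using assms lip_norm_le by (auto simp: Lip0_def)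
qed

lemma Lip0_fscale:
  fixes \<phi> :: "'a::metric_space \<Rightarrow> 'k::real_normed_field"
  assumes "\<phi> \<in> Lip0 e"
  shows "fscale c \<phi> \<in> Lip0 e" "lip_norm (fscale c \<phi>) \<le> norm c * lip_norm \<phi>"
proof -
  have "norm (fscale c \<phi> x - fscale c \<phi> y) \<le> (norm c * lip_norm \<phi>) * dist x y" for x y
    using mult_left_mono[OF Lip0_dist[OF assms, of x y], of "norm c"]
    by (simp add: fscale_def right_diff_distrib[symmetric] norm_mult mult.assoc)
  moreover have "fscale c \<phi> e = 0" using assms by (auto simp: Lip0_def fscale_def)
  moreover have "0 \<le> norm c * lip_norm \<phi>" using lip_norm_nonneg[OF assms] by simp
  ultimately show "fscale c \<phi> \<in> Lip0 e" "lip_norm (fscale c \<phi>) \<le> norm c * lip_norm \<phi>"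
    using Lip0I by blast+
qed

lemma Lip0_zero:
  "(0 :: 'a::metric_space \<Rightarrow> 'k::real_normed_field) \<in> Lip0 e"
  "lip_norm (0 :: 'a \<Rightarrow> 'k) \<le> 0"
  by (rule Lip0I[of _ e 0]; simp)+

lemma Lip0_add:
  fixes \<phi> :: "'a::metric_space \<Rightarrow> 'k::real_normed_field"
  assumes "\<phi> \<in> Lip0 e" "\<psi> \<in> Lip0 e"
  shows "\<phi> + \<psi> \<in> Lip0 e"
proof (rule Lip0I)
  show "(\<phi> + \<psi>) e = 0" using assms by (auto simp: Lip0_def)
  show "0 \<le> lip_norm \<phi> + lip_norm \<psi>" using assms by (simp add: lip_norm_nonneg)
  fix x y
  show "norm ((\<phi> + \<psi>) x - (\<phi> + \<psi>) y) \<le> (lip_norm \<phi> + lip_norm \<psi>) * dist x y"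
    using Lip0_dist[OF assms(1), of x y] Lip0_dist[OF assms(2), of x y]
      norm_triangle_ineq[of "\<phi> x - \<phi> y" "\<psi> x - \<psi> y"]
    by (simp add: algebra_simps)
qed

lemma Lip0_dual_iff:
  "F \<in> Lip0_dual e \<longleftrightarrow>
    (\<forall>\<phi>\<in>Lip0 e. \<forall>\<psi>\<in>Lip0 e. F (\<phi> + \<psi>) = F \<phi> + F \<psi>) \<and>
    (\<forall>c. \<forall>\<phi>\<in>Lip0 e. F (fscale c \<phi>) = c * F \<phi>) \<and>
    (\<exists>B. \<forall>\<phi>\<in>Lip0 e. norm (F \<phi>) \<le> B * lip_norm \<phi>) \<and> (\<forall>\<phi>. \<phi> \<notin> Lip0 e \<longrightarrow> F \<phi> = 0)"
  unfolding Lip0_dual_def bounded_operator_def by auto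

lemma dual_norm_bdd:
  assumes "F \<in> Lip0_dual e"
  shows "bdd_above ((\<lambda>\<phi>. norm (F \<phi>)) ` {\<phi> \<in> Lip0 e. lip_norm \<phi> \<le> 1})"
proof -
  obtain B where B: "\<And>\<phi>. \<phi> \<in> Lip0 e \<Longrightarrow> norm (F \<phi>) \<le> B * lip_norm \<phi>"
    using assms unfolding Lip0_dual_iff by blast
  have "norm (F \<phi>) \<le> \<bar>B\<bar>" if "\<phi> \<in> Lip0 e" "lip_norm \<phi> \<le> 1" for \<phi>
  proof -
    have "B * lip_norm \<phi> \<le> \<bar>B\<bar> * lip_norm \<phi>"
      by (rule mult_right_mono) (use lip_norm_nonneg[OF that(1)] in auto)
    also have "\<dots> \<le> \<bar>B\<bar>" using that mult_left_mono[of "lip_norm \<phi>" 1 "\<bar>B\<bar>"] by simp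
    finally show ?thesis using B[OF that(1)] by simp
  qed
  then show ?thesis by (auto intro!: bdd_aboveI)
qed

lemma dual_norm_leI:
  fixes F :: "('a::metric_space \<Rightarrow> 'b::real_normed_field) \<Rightarrow> 'b"
  assumes "\<And>\<phi>. \<phi> \<in> Lip0 e \<Longrightarrow> lip_norm \<phi> \<le> 1 \<Longrightarrow> norm (F \<phi>) \<le> B"
  shows "dual_norm e F \<le> B"
  unfolding dual_norm_def
proof (rule cSUP_least)
  show "{\<phi> \<in> Lip0 e. lip_norm (\<phi> :: 'a \<Rightarrow> 'b) \<le> 1} \<noteq> {}"
    using Lip0_zero(1)[of e] order_trans[OF Lip0_zero(2) zero_le_one] by blast
qed (use assms in auto)

lemma dual_norm_unit:
  assumes "F \<in> Lip0_dual e" "\<phi> \<in> Lip0 e" "lip_norm \<phi> \<le> 1"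
  shows "norm (F \<phi>) \<le> dual_norm e F"
  unfolding dual_norm_def by (rule cSUP_upper[OF _ dual_norm_bdd]) (use assms in auto)

lemma dual_norm_nonneg: "F \<in> Lip0_dual e \<Longrightarrow> 0 \<le> dual_norm e F"
  by (rule order_trans[OF norm_ge_zero dual_norm_unit[of _ e 0]])
    (use Lip0_zero in \<open>auto intro: order_trans\<close>)

lemma dual_norm_bound:
  fixes \<phi> :: "'a::metric_space \<Rightarrow> 'k::real_normed_field"
  assumes "F \<in> Lip0_dual e" "\<phi> \<in> Lip0 e"
  shows "norm (F \<phi>) \<le> dual_norm e F * lip_norm \<phi>"
proof (cases "lip_norm \<phi> = 0")
  case True
  then show ?thesis using assms unfolding Lip0_dual_iff by fastforce
next
  case False
  define l where "l = lip_norm \<phi>"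
  have l: "l > 0" using False lip_norm_nonneg[OF assms(2)] l_def by simp
  have "norm (of_real (inverse l) :: 'k) = inverse l"
    using l by (simp only: norm_of_real abs_of_pos positive_imp_inverse_positive)
  note il = this
  have "lip_norm (fscale (of_real (inverse l)) \<phi>) \<le> 1"
    using Lip0_fscale(2)[OF assms(2), of "of_real (inverse l)"] l
    by (simp only: l_def[symmetric] il) simp
  then have "norm (F (fscale (of_real (inverse l)) \<phi>)) \<le> dual_norm e F"
    by (intro dual_norm_unit Lip0_fscale assms)
  moreover have "F (fscale (of_real (inverse l)) \<phi>) = of_real (inverse l) * F \<phi>"
    using assms unfolding Lip0_dual_iff by blast
  ultimately have "inverse l * norm (F \<phi>) \<le> dual_norm e F"
    by (simp only: norm_mult il)
  then show ?thesis
    using l by (simp add: l_def[symmetric] field_simps)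
qed

lemma Lip0_dual_add:
  assumes F: "F \<in> Lip0_dual e" and G: "G \<in> Lip0_dual e"
  shows "F + G \<in> Lip0_dual e" "dual_norm e (F + G) \<le> dual_norm e F + dual_norm e G"
proof -
  have "norm ((F + G) \<phi>) \<le> (dual_norm e F + dual_norm e G) * lip_norm \<phi>" if "\<phi> \<in> Lip0 e" for \<phi>
    using dual_norm_bound[OF F that] dual_norm_bound[OF G that] norm_triangle_ineq[of "F \<phi>" "G \<phi>"]
    by (simp add: algebra_simps)
  then have "\<exists>B. \<forall>\<phi>\<in>Lip0 e. norm ((F + G) \<phi>) \<le> B * lip_norm \<phi>" by blast
  moreover have "\<forall>\<phi>\<in>Lip0 e. \<forall>\<psi>\<in>Lip0 e. (F + G) (\<phi> + \<psi>) = (F + G) \<phi> + (F + G) \<psi>"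
    "\<forall>b. \<forall>\<phi>\<in>Lip0 e. (F + G) (fscale b \<phi>) = b * (F + G) \<phi>"
    "\<forall>\<phi>. \<phi> \<notin> Lip0 e \<longrightarrow> (F + G) \<phi> = 0"
    using F G unfolding Lip0_dual_iff by (auto simp: algebra_simps)
  ultimately show "F + G \<in> Lip0_dual e" unfolding Lip0_dual_iff by blast
  show "dual_norm e (F + G) \<le> dual_norm e F + dual_norm e G"
    by (rule dual_norm_leI)
      (use dual_norm_unit[OF F] dual_norm_unit[OF G] in
        \<open>auto intro!: order_trans[OF norm_triangle_ineq] add_mono\<close>)
qed

lemma Lip0_dual_fscale:
  assumes F: "F \<in> Lip0_dual e"
  shows "fscale c F \<in> Lip0_dual e" "dual_norm e (fscale c F) \<le> norm c * dual_norm e F"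
proof -
  have "norm (fscale c F \<phi>) \<le> (norm c * dual_norm e F) * lip_norm \<phi>" if "\<phi> \<in> Lip0 e" for \<phi>
    using mult_left_mono[OF dual_norm_bound[OF F that], of "norm c"]
    by (simp add: fscale_def norm_mult mult.assoc)
  then have "\<exists>B. \<forall>\<phi>\<in>Lip0 e. norm (fscale c F \<phi>) \<le> B * lip_norm \<phi>" by blast
  moreover have "\<forall>\<phi>\<in>Lip0 e. \<forall>\<psi>\<in>Lip0 e. fscale c F (\<phi> + \<psi>) = fscale c F \<phi> + fscale c F \<psi>"
    "\<forall>b. \<forall>\<phi>\<in>Lip0 e. fscale c F (fscale b \<phi>) = b * fscale c F \<phi>"
    "\<forall>\<phi>. \<phi> \<notin> Lip0 e \<longrightarrow> fscale c F \<phi> = 0"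
    using F unfolding Lip0_dual_iff fscale_def[of c] by (auto simp: algebra_simps)
  ultimately show "fscale c F \<in> Lip0_dual e" unfolding Lip0_dual_iff by blast
  show "dual_norm e (fscale c F) \<le> norm c * dual_norm e F"
    by (rule dual_norm_leI)
      (use dual_norm_unit[OF F] in \<open>auto simp: fscale_def norm_mult intro: mult_left_mono\<close>)
qed

lemma Lip0_dual_zero: "0 \<in> Lip0_dual e"
  unfolding Lip0_dual_iff by (auto intro!: exI[of _ 0])

lemma dual_norm_zero: "dual_norm e 0 = 0"
  by (rule antisym[OF dual_norm_leI dual_norm_nonneg[OF Lip0_dual_zero]]) simp

lemma Lip0_dual_subspace: "fs.subspace (Lip0_dual e)"
  by (rule fs.subspaceI) (auto simp: Lip0_dual_zero Lip0_dual_add Lip0_dual_fscale)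

lemmas Lip0_dual_diff = fs.subspace_diff[OF Lip0_dual_subspace]

lemma dual_norm_commute:
  assumes "F \<in> Lip0_dual e" "G \<in> Lip0_dual e"
  shows "dual_norm e (F - G) = dual_norm e (G - F)"
  unfolding dual_norm_def by (simp add: norm_minus_commute)

lemma dual_norm_eq_0D:
  assumes "F \<in> Lip0_dual e" "dual_norm e F \<le> 0"
  shows "F = 0"
proof
  fix \<phi>
  have "dual_norm e F = 0" using dual_norm_nonneg[OF assms(1)] assms(2) by linarith
  then show "F \<phi> = 0 \<phi>"
    using dual_norm_bound[OF assms(1), of \<phi>] assms(1) by (cases "\<phi> \<in> Lip0 e") (auto simp: Lip0_dual_iff)
qed

lemma delta_in_dual: "(delta e x :: ('a::metric_space \<Rightarrow> 'k::real_normed_field) \<Rightarrow> 'k) \<in> Lip0_dual e"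
proof -
  have "norm (delta e x \<phi>) \<le> dist x e * lip_norm \<phi>" if "\<phi> \<in> Lip0 e" for \<phi> :: "'a \<Rightarrow> 'k"
    using Lip0_dist[OF that, of x e] that by (simp add: delta_def Lip0_def mult.commute)
  then have "\<exists>B. \<forall>\<phi>::'a \<Rightarrow> 'k\<in>Lip0 e. norm (delta e x \<phi>) \<le> B * lip_norm \<phi>" by blast
  then show ?thesis
    unfolding Lip0_dual_iff by (simp add: delta_def Lip0_add Lip0_fscale) (simp add: fscale_def)
qed

lemma span_delta_dual: "fs.span (range (delta e)) \<subseteq> Lip0_dual e"
  by (rule fs.span_minimal) (auto simp: delta_in_dual Lip0_dual_subspace)

lemma span_subset_free: "fs.span (range (delta e)) \<subseteq> free_space e"
proof
  fix F :: "('a \<Rightarrow> 'b) \<Rightarrow> 'b" assume F: "F \<in> fs.span (range (delta e))"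
  then have "\<exists>v\<in>fs.span (range (delta e)). dual_norm e (F - v) < \<epsilon>" if "\<epsilon> > 0" for \<epsilon>
    using that by (intro bexI[of _ F]) (auto simp: dual_norm_zero)
  then show "F \<in> free_space e"
    using F span_delta_dual unfolding free_space_def norm_closure_def by blast
qed

lemma delta_in_free: "delta e x \<in> free_space e"
  using span_subset_free fs.span_base by blast

lemma free_subset_dual: "free_space e \<subseteq> Lip0_dual e"
  unfolding free_space_def norm_closure_def by auto

lemma free_approx:
  assumes "F \<in> free_space e" "\<epsilon> > 0"
  obtains G where "G \<in> fs.span (range (delta e))" "dual_norm e (F - G) < \<epsilon>"
  using assms unfolding free_space_def norm_closure_def by blast

lemma free_spaceI:
  assumes "F \<in> Lip0_dual e"
    and "\<And>\<epsilon>. \<epsilon> > 0 \<Longrightarrow> \<exists>G\<in>fs.span (range (delta e)). dual_norm e (F - G) < \<epsilon>"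
  shows "F \<in> free_space e"
  using assms unfolding free_space_def norm_closure_def by blast

lemma free_subspace: "fs.subspace (free_space e :: (('a::metric_space \<Rightarrow> 'k::real_normed_field) \<Rightarrow> 'k) set)"
proof (rule fs.subspaceI)
  show "0 \<in> (free_space e :: (('a \<Rightarrow> 'k) \<Rightarrow> 'k) set)" using span_subset_free fs.span_zero by blast
next
  fix F G :: "('a \<Rightarrow> 'k) \<Rightarrow> 'k"
  assume F: "F \<in> free_space e" and G: "G \<in> free_space e"
  note FG = subsetD[OF free_subset_dual F] subsetD[OF free_subset_dual G]
  show "F + G \<in> free_space e"
  proof (rule free_spaceI)
    show "F + G \<in> Lip0_dual e" using FG Lip0_dual_add by blast
    fix \<epsilon> :: real assume "\<epsilon> > 0"
    then have e2: "\<epsilon> / 2 > 0" by simp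
    obtain F' where F': "F' \<in> fs.span (range (delta e))" "dual_norm e (F - F') < \<epsilon> / 2"
      using free_approx[OF F e2] .
    obtain G' where G': "G' \<in> fs.span (range (delta e))" "dual_norm e (G - G') < \<epsilon> / 2"
      using free_approx[OF G e2] .
    have "dual_norm e ((F - F') + (G - G')) \<le> dual_norm e (F - F') + dual_norm e (G - G')"
      using FG F'(1) G'(1) span_delta_dual by (intro Lip0_dual_add Lip0_dual_diff) auto
    moreover have "(F - F') + (G - G') = (F + G) - (F' + G')" by simp
    ultimately show "\<exists>H\<in>fs.span (range (delta e)). dual_norm e (F + G - H) < \<epsilon>"
      using F' G' by (intro bexI[of _ "F' + G'"] fs.span_add) auto
  qed
next
  fix c and F :: "('a \<Rightarrow> 'k) \<Rightarrow> 'k"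
  assume F: "F \<in> free_space e"
  note FD = subsetD[OF free_subset_dual F]
  show "fscale c F \<in> free_space e"
  proof (rule free_spaceI)
    show "fscale c F \<in> Lip0_dual e" using FD Lip0_dual_fscale by blast
    fix \<epsilon> :: real assume "\<epsilon> > 0"
    then have e2: "\<epsilon> / (norm c + 1) > 0" by (simp add: add_nonneg_pos)
    obtain F' where F': "F' \<in> fs.span (range (delta e))" "dual_norm e (F - F') < \<epsilon> / (norm c + 1)"
      using free_approx[OF F e2] .
    have D: "F - F' \<in> Lip0_dual e" using FD F'(1) span_delta_dual by (intro Lip0_dual_diff) auto
    have "dual_norm e (fscale c (F - F')) \<le> norm c * dual_norm e (F - F')"
      using D by (rule Lip0_dual_fscale)
    also have "\<dots> \<le> (norm c + 1) * dual_norm e (F - F')"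
      using dual_norm_nonneg[OF D] by (simp add: mult_right_mono)
    also have "\<dots> < (norm c + 1) * (\<epsilon> / (norm c + 1))"
      by (rule mult_strict_left_mono[OF F'(2)]) (simp add: add_nonneg_pos)
    also have "\<dots> = \<epsilon>" using add_nonneg_pos[OF norm_ge_zero[of c] zero_less_one] by simp
    finally show "\<exists>H\<in>fs.span (range (delta e)). dual_norm e (fscale c F - H) < \<epsilon>"
      using F'(1) by (intro bexI[of _ "fscale c F'"] fs.span_scale) (auto simp: fs.scale_right_diff_distrib)
  qed
qed

lemma bounded_operator_diff:
  assumes "bounded_operator fscale X N fscale Y N' T" "fs.subspace X" "u \<in> X" "v \<in> X"
  shows "T (u - v) = T u - T v"
proof -
  have "fscale (- 1) v \<in> X" using assms by (intro fs.subspace_scale)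
  moreover have "T (u + w) = T u + T w" if "w \<in> X" for w
    using assms(1,3) that unfolding bounded_operator_def by blast
  moreover have "T (fscale b v) = fscale b (T v)" for b
    using assms(1,4) unfolding bounded_operator_def by blast
  ultimately have "T (u + fscale (- 1) v) = T u + fscale (- 1) (T v)" by (simp only:)
  then show ?thesis by (simp only: fscale_minus1[symmetric] diff_conv_add_uminus)
qed

lemma free_op_unique:
  fixes T S :: "(('a::metric_space \<Rightarrow> 'k::real_normed_field) \<Rightarrow> 'k) \<Rightarrow> (('a \<Rightarrow> 'k) \<Rightarrow> 'k)"
  assumes T: "is_free_op f e T" and S: "is_free_op f e S"
  shows "T = S"
proof (rule extensionalityI)
  let ?X = "free_space e :: (('a \<Rightarrow> 'k) \<Rightarrow> 'k) set"
  let ?N = "dual_norm e :: (('a \<Rightarrow> 'k) \<Rightarrow> 'k) \<Rightarrow> real"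
  show "T \<in> extensional ?X" "S \<in> extensional ?X" using T S by (auto simp: is_free_op_def)
  have bT: "bounded_operator fscale ?X ?N fscale ?X ?N T"
    and bS: "bounded_operator fscale ?X ?N fscale ?X ?N S"
    using T S by (auto simp: is_free_op_def)
  obtain B where B: "\<And>u. u \<in> ?X \<Longrightarrow> ?N (T u) \<le> B * ?N u"
    using bT unfolding bounded_operator_def by blast
  obtain C where C: "\<And>u. u \<in> ?X \<Longrightarrow> ?N (S u) \<le> C * ?N u"
    using bS unfolding bounded_operator_def by blast
  define K where "K = \<bar>B\<bar> + \<bar>C\<bar> + 1"
  have K: "K > 0" by (simp add: K_def)
  have sub: "fs.subspace {u \<in> ?X. T u = S u}"
  proof (rule fs.subspaceI)
    note X = free_subspace[where 'k='k, of e]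
    have "T (0 - 0) = T 0 - T 0" "S (0 - 0) = S 0 - S 0"
      using bounded_operator_diff[OF bT X] bounded_operator_diff[OF bS X] fs.subspace_0[OF X] by blast+
    then show "0 \<in> {u \<in> ?X. T u = S u}" using fs.subspace_0[OF X] by simp
    show "u + v \<in> {u \<in> ?X. T u = S u}"
      if "u \<in> {u \<in> ?X. T u = S u}" "v \<in> {u \<in> ?X. T u = S u}" for u v
      using that bT bS fs.subspace_add[OF X] unfolding bounded_operator_def by simp
    show "fscale b u \<in> {u \<in> ?X. T u = S u}" if "u \<in> {u \<in> ?X. T u = S u}" for b u
      using that bT bS fs.subspace_scale[OF X] unfolding bounded_operator_def by simp
  qed
  have eq: "T u = S u" if "u \<in> fs.span (range (delta e))" for u
  proof -
    have "range (delta e) \<subseteq> {u \<in> ?X. T u = S u}"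
      using T S delta_in_free unfolding is_free_op_def by auto
    then show ?thesis using fs.span_minimal[OF _ sub] that by blast
  qed
  fix F assume F: "F \<in> ?X"
  have TSd: "T F \<in> Lip0_dual e" "S F \<in> Lip0_dual e"
    using F bT bS free_subset_dual unfolding bounded_operator_def by blast+
  have "?N (T F - S F) \<le> 0 + \<epsilon>" if "\<epsilon> > 0" for \<epsilon>
  proof -
    have "\<epsilon> / K > 0" using that K by simp
    then obtain G where G: "G \<in> fs.span (range (delta e))" "?N (F - G) < \<epsilon> / K"
      using free_approx[OF F] by blast
    have GX: "G \<in> ?X" using G span_subset_free by blast
    have D: "F - G \<in> ?X" using F GX fs.subspace_diff[OF free_subspace] by blast
    then have DD: "T (F - G) \<in> Lip0_dual e" "S (F - G) \<in> Lip0_dual e"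
      using bT bS free_subset_dual unfolding bounded_operator_def by blast+
    have "T F - S F = T (F - G) + fscale (- 1) (S (F - G))"
      using bounded_operator_diff[OF bT free_subspace F GX]
        bounded_operator_diff[OF bS free_subspace F GX] eq[OF G(1)]
      by (simp add: fscale_minus1[symmetric])
    then have "?N (T F - S F) \<le> ?N (T (F - G)) + ?N (fscale (- 1) (S (F - G)))"
      using Lip0_dual_add(2)[OF DD(1) Lip0_dual_fscale(1)[OF DD(2), of "- 1"]] by simp
    also have "\<dots> \<le> ?N (T (F - G)) + ?N (S (F - G))"
      using Lip0_dual_fscale(2)[OF DD(2), of "- 1"] by simp
    also have "\<dots> \<le> B * ?N (F - G) + C * ?N (F - G)" using B[OF D] C[OF D] by simp
    also have "\<dots> \<le> K * ?N (F - G)"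
      unfolding K_def distrib_right[symmetric]
      by (rule mult_right_mono) (use dual_norm_nonneg[OF subsetD[OF free_subset_dual D]] in auto)
    also have "\<dots> \<le> \<epsilon>" using G(2) K by (simp add: field_simps)
    finally show ?thesis by simp
  qed
  then have "?N (T F - S F) \<le> 0" by (rule field_le_epsilon)
  then show "T F = S F"
    using dual_norm_eq_0D[OF Lip0_dual_diff[OF TSd]] by simp
qed

lemma free_op_ex:
  fixes f :: "'a::metric_space \<Rightarrow> 'a"
  assumes "L-lipschitz_on UNIV f"
  shows "\<exists>T :: (('a \<Rightarrow> 'k::real_normed_field) \<Rightarrow> 'k) \<Rightarrow> (('a \<Rightarrow> 'k) \<Rightarrow> 'k). is_free_op f e T"
proof -
  let ?X = "free_space e :: (('a \<Rightarrow> 'k) \<Rightarrow> 'k) set"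
  let ?Y = "Lip0_dual e :: (('a \<Rightarrow> 'k) \<Rightarrow> 'k) set"
  let ?N = "dual_norm e :: (('a \<Rightarrow> 'k) \<Rightarrow> 'k) \<Rightarrow> real"
  have L: "0 \<le> L" "\<And>x y. dist (f x) (f y) \<le> L * dist x y"
    using assms by (auto simp: lipschitz_on_def)
  define c :: "('a \<Rightarrow> 'k) \<Rightarrow> 'a \<Rightarrow> 'k" where "c \<phi> = (\<lambda>x. \<phi> (f x) - \<phi> (f e))" for \<phi>
  have c: "c \<phi> \<in> Lip0 e" "lip_norm (c \<phi>) \<le> L * lip_norm \<phi>" if "\<phi> \<in> Lip0 e" for \<phi>
  proof -
    have "norm (c \<phi> x - c \<phi> y) \<le> (L * lip_norm \<phi>) * dist x y" for x y
      using Lip0_dist[OF that, of "f x" "f y"]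
        mult_left_mono[OF L(2)[of x y] lip_norm_nonneg[OF that]]
      by (simp add: c_def mult_ac)
    moreover have "c \<phi> e = 0" "0 \<le> L * lip_norm \<phi>"
      using lip_norm_nonneg[OF that] L by (simp_all add: c_def)
    ultimately show "c \<phi> \<in> Lip0 e" "lip_norm (c \<phi>) \<le> L * lip_norm \<phi>" using Lip0I by blast+
  qed
  have c_lin: "c (\<phi> + \<psi>) = c \<phi> + c \<psi>" "c (fscale b \<phi>) = fscale b (c \<phi>)" for \<phi> \<psi> b
    by (auto simp: c_def fscale_def fun_eq_iff algebra_simps)
  define A :: "(('a \<Rightarrow> 'k) \<Rightarrow> 'k) \<Rightarrow> (('a \<Rightarrow> 'k) \<Rightarrow> 'k)"
    where "A F = (\<lambda>\<phi>. if \<phi> \<in> Lip0 e then F (c \<phi>) else 0)" for F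
  have A_lin: "A (F + G) = A F + A G" "A (fscale b F) = fscale b (A F)" for F G b
    by (auto simp: A_def fscale_def fun_eq_iff)
  have A_diff: "A (F - G) = A F - A G" for F G
    by (auto simp: A_def fun_eq_iff)
  have A_bd: "norm (A F \<phi>) \<le> (L * ?N F) * lip_norm \<phi>" if "F \<in> ?Y" "\<phi> \<in> Lip0 e" for F \<phi>
  proof -
    have "norm (A F \<phi>) \<le> ?N F * lip_norm (c \<phi>)"
      using dual_norm_bound[OF that(1) c(1)] that by (simp add: A_def)
    also have "\<dots> \<le> ?N F * (L * lip_norm \<phi>)"
      by (rule mult_left_mono[OF c(2) dual_norm_nonneg]) (use that in auto)
    finally show ?thesis by (simp add: mult_ac)
  qed
  have A_norm: "?N (A F) \<le> L * ?N F" if "F \<in> ?Y" for F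
  proof (rule dual_norm_leI)
    fix \<phi> :: "'a \<Rightarrow> 'k" assume p: "\<phi> \<in> Lip0 e" "lip_norm \<phi> \<le> 1"
    have "(L * ?N F) * lip_norm \<phi> \<le> (L * ?N F) * 1"
      by (rule mult_left_mono[OF p(2)]) (use L dual_norm_nonneg[OF that] in simp)
    then show "norm (A F \<phi>) \<le> L * ?N F" using A_bd[OF that p(1)] by simp
  qed
  have A_dual: "A F \<in> ?Y" if "F \<in> ?Y" for F
    using that A_bd[OF that] unfolding Lip0_dual_iff
    by (auto simp: A_def c c_lin Lip0_add Lip0_fscale intro!: exI[of _ "L * ?N F"])
  have A_delta: "A (delta e x) = delta e (f x) - delta e (f e)" for x
    by (auto simp: A_def delta_def c fun_eq_iff) (simp add: c_def)
  have sub: "fs.subspace {F. A F \<in> fs.span (range (delta e))}"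
  proof (rule fs.subspaceI)
    have "A 0 = 0" by (auto simp: A_def)
    then show "0 \<in> {F. A F \<in> fs.span (range (delta e))}" by (simp add: fs.span_zero)
  qed (auto simp: A_lin fs.span_add fs.span_scale)
  have A_span: "A F \<in> fs.span (range (delta e))" if "F \<in> fs.span (range (delta e))" for F
  proof -
    have "A (delta e x) \<in> fs.span (range (delta e))" for x
      unfolding A_delta by (intro fs.span_diff fs.span_base rangeI)
    then show ?thesis using fs.span_minimal[OF _ sub] that by blast
  qed
  have A_free: "A F \<in> ?X" if F: "F \<in> ?X" for F
  proof (rule free_spaceI)
    have FD: "F \<in> ?Y" using F free_subset_dual by blast
    then show "A F \<in> ?Y" by (rule A_dual)
    fix \<epsilon> :: real assume "\<epsilon> > 0"
    then have "\<epsilon> / (L + 1) > 0" using L by simp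
    then obtain G where G: "G \<in> fs.span (range (delta e))" "?N (F - G) < \<epsilon> / (L + 1)"
      using free_approx[OF F] by blast
    have D: "F - G \<in> ?Y" using FD G(1) span_delta_dual by (intro Lip0_dual_diff) auto
    have "?N (A F - A G) \<le> L * ?N (F - G)" using A_norm[OF D] by (simp add: A_diff)
    also have "\<dots> \<le> (L + 1) * ?N (F - G)"
      using dual_norm_nonneg[OF D] by (simp add: mult_right_mono)
    also have "\<dots> < \<epsilon>" using G(2) L by (simp add: field_simps)
    finally show "\<exists>H\<in>fs.span (range (delta e)). ?N (A F - H) < \<epsilon>"
      using A_span[OF G(1)] by blast
  qed
  have "is_free_op f e (restrict A ?X)"
    unfolding is_free_op_def bounded_operator_def
  proof (intro conjI)
    note X = free_subspace[where 'k='k, of e]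
    show "\<forall>u\<in>?X. \<forall>v\<in>?X. restrict A ?X (u + v) = restrict A ?X u + restrict A ?X v"
      by (simp add: fs.subspace_add[OF X] A_lin)
    show "\<forall>b. \<forall>u\<in>?X. restrict A ?X (fscale b u) = fscale b (restrict A ?X u)"
      by (simp add: fs.subspace_scale[OF X] A_lin)
    show "\<exists>B. \<forall>u\<in>?X. ?N (restrict A ?X u) \<le> B * ?N u"
    proof (intro exI ballI)
      show "?N (restrict A ?X u) \<le> L * ?N u" if "u \<in> ?X" for u
        using A_norm[OF subsetD[OF free_subset_dual that]] that by simp
    qed
    show "\<forall>x. restrict A ?X (delta e x) = delta e (f x) - delta e (f e)"
      by (simp add: delta_in_free A_delta)
  qed (simp_all add: A_free)
  then show ?thesis by blast
qed

theorem free_op_ex1: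
  fixes f :: "'a::metric_space \<Rightarrow> 'a"
  assumes "L-lipschitz_on UNIV f"
  shows "\<exists>!T :: (('a \<Rightarrow> 'k::real_normed_field) \<Rightarrow> 'k) \<Rightarrow> (('a \<Rightarrow> 'k) \<Rightarrow> 'k). is_free_op f e T"
  by (rule ex_ex1I[OF free_op_ex[OF assms]]) (rule free_op_unique)

end

theory Submission
  imports Defs
begin

text \<open>
  Write \<open>x\<^sub>n = f\<^sup>n(x)\<close>. Since \<open>\<delta>(x\<^sub>1) = \<delta>(e) = 0\<close>, we have
  \<open>T(\<delta>(x)) = - \<delta>(x\<^sub>2)\<close> and \<open>T(\<delta>(x\<^sub>n)) = \<delta>(x\<^sub>n\<^sub>+\<^sub>1) - \<delta>(x\<^sub>2)\<close>, so the orbit of \<open>\<delta>(x)\<close> under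
  \<open>T\<close> spans the same subspace as the points \<open>\<delta>(x\<^sub>n)\<close>. As \<open>\<delta>\<close> is nonexpansive, this subspace is dense
  if the points \<open>x\<^sub>n\<close> are. If they miss a ball around \<open>y\<close>, then a Lipschitz bump function supported in
  that ball vanishes at \<open>e = x\<^sub>1\<close>, annihilates all \<open>\<delta>(x\<^sub>n)\<close>, and does not annihilate \<open>\<delta>(y)\<close>.
\<close>

lemma Orb_self: "x \<in> Orb x f"
  unfolding Orb_def by (auto intro: exI[of _ 0])

lemma Orb_image: "y \<in> Orb x f \<Longrightarrow> f y \<in> Orb x f"
  unfolding Orb_def by (auto intro: exI[of _ "Suc _"])

lemma Orb_minimal:
  assumes "x \<in> S" "\<And>y. y \<in> S \<Longrightarrow> f y \<in> S"
  shows "Orb x f \<subseteq> S"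
proof -
  have "(f ^^ n) x \<in> S" for n
    by (induction n) (use assms in auto)
  then show ?thesis by (auto simp: Orb_def)
qed

text \<open>\<open>T\<close> is linear only on the carrier \<open>X\<close>, so the usual facts on
  images of spans do not apply. Instead, the vectors of \<open>X\<close> that \<open>T\<close> sends
  into \<open>V\<close> form a subspace containing \<open>S\<close>. With \<open>V\<close> itself a
  span, this gives the \<open>T\<close>-invariance of spans used below.\<close>

lemma bounded_operator_span_image:
  assumes T: "bounded_operator fscale X N fscale Y N' T" and X: "fs.subspace X"
    and "S \<subseteq> X" and V: "fs.subspace V" and TS: "T ` S \<subseteq> V" and u: "u \<in> fs.span S"
  shows "T u \<in> V"
proof -
  have "fs.subspace {u \<in> X. T u \<in> V}"
  proof (rule fs.subspaceI)
    \<comment> \<open>This is how \<open>T 0 = 0\<close> is obtained: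
      \<open>bounded_operator\<close> does not list it, but \<open>T\<close> respects differences on
      \<open>X\<close>.\<close>
    have "T (0 - 0) = T 0 - T 0"
      using bounded_operator_diff[OF T X] fs.subspace_0[OF X] by blast
    then show "0 \<in> {u \<in> X. T u \<in> V}"
      using fs.subspace_0[OF X] fs.subspace_0[OF V] by simp
    show "u + v \<in> {u \<in> X. T u \<in> V}" if "u \<in> {u \<in> X. T u \<in> V}" "v \<in> {u \<in> X. T u \<in> V}" for u v
      using that T fs.subspace_add[OF X] fs.subspace_add[OF V] unfolding bounded_operator_def by simp
    show "fscale c u \<in> {u \<in> X. T u \<in> V}" if "u \<in> {u \<in> X. T u \<in> V}" for c u
      using that T fs.subspace_scale[OF X] fs.subspace_scale[OF V] unfolding bounded_operator_def by simp
  qed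
  moreover have "S \<subseteq> {u \<in> X. T u \<in> V}"
    using \<open>S \<subseteq> X\<close> TS by blast
  ultimately show ?thesis
    using fs.span_minimal u by blast
qed

lemma delta_base: "delta e e = 0"
  by (auto simp: delta_def Lip0_def fun_eq_iff)

lemma dual_norm_delta_diff_le: "dual_norm e (delta e x - delta e y) \<le> dist x y"
proof (rule dual_norm_leI)
  fix \<phi> :: "'a \<Rightarrow> 'b" assume \<phi>: "\<phi> \<in> Lip0 e" "lip_norm \<phi> \<le> 1"
  have "norm (\<phi> x - \<phi> y) \<le> lip_norm \<phi> * dist x y"
    by (rule Lip0_dist[OF \<phi>(1)])
  also have "\<dots> \<le> 1 * dist x y"
    by (rule mult_right_mono) (use \<phi> in auto)
  finally show "norm ((delta e x - delta e y) \<phi>) \<le> dist x y"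
    using \<phi> by (simp add: delta_def)
qed

lemma is_free_op_free_op:
  assumes "L-lipschitz_on UNIV f"
  shows "is_free_op f e (free_op f e)"
  unfolding free_op_def by (rule theI'[OF free_op_ex1[OF assms]])

text \<open>Each span is \<open>T\<close>-invariant and contains the start of the other orbit. Going
  from the \<open>T\<close>-orbit back to the points requires undoing the shift by
  \<open>delta e (f e)\<close>, which is possible once that vector is known to lie in
  \<open>?W\<close>.\<close>

lemma span_Orb_free_op:
  fixes f :: "'a::metric_space \<Rightarrow> 'a"
    and T :: "(('a \<Rightarrow> 'k::real_normed_field) \<Rightarrow> 'k) \<Rightarrow> (('a \<Rightarrow> 'k) \<Rightarrow> 'k)"
  assumes T: "is_free_op f e T" and e: "e = f x"
  shows "fs.span (Orb (delta e x) T) = fs.span (delta e ` Orb x f)"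
proof -
  let ?X = "free_space e :: (('a \<Rightarrow> 'k) \<Rightarrow> 'k) set"
  let ?W = "fs.span (Orb (delta e x) T)"
  let ?V = "fs.span (delta e ` Orb x f) :: (('a \<Rightarrow> 'k) \<Rightarrow> 'k) set"
  have bT: "bounded_operator fscale ?X (dual_norm e) fscale ?X (dual_norm e) T"
    and T_delta: "T (delta e y) = delta e (f y) - delta e (f e)" for y
    using T by (auto simp: is_free_op_def)
  have Orb_X: "Orb (delta e x) T \<subseteq> ?X"
    by (rule Orb_minimal) (use bT delta_in_free in \<open>auto simp: bounded_operator_def\<close>)
  have W_inv: "T u \<in> ?W" if "u \<in> ?W" for u
    by (rule bounded_operator_span_image[OF bT free_subspace Orb_X _ _ that])
      (auto intro: fs.span_base Orb_image)
  have x_W: "delta e x \<in> ?W"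
    by (intro fs.span_base Orb_self)
  \<comment> \<open>The choice \<open>e = f x\<close> enters here:
    \<open>T (delta e x) = delta e e - delta e (f e)\<close>, and
    \<open>delta e e = 0\<close>.\<close>
  have "delta e (f e) = - T (delta e x)"
    by (simp add: T_delta e[symmetric] delta_base)
  then have fe_W: "delta e (f e) \<in> ?W"
    using fs.span_neg[OF W_inv[OF x_W]] by simp
  have "delta e (f y) \<in> ?W" if "delta e y \<in> ?W" for y
    using fs.span_add[OF W_inv[OF that] fe_W] by (simp add: T_delta)
  then have "Orb x f \<subseteq> {y. delta e y \<in> ?W}"
    using x_W by (intro Orb_minimal) auto
  then have "?V \<subseteq> ?W"
    by (intro fs.span_minimal) auto
  have fe_Orb: "f e \<in> Orb x f"
    by (simp add: e Orb_image Orb_self)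
  have "T (delta e y) \<in> ?V" if "y \<in> Orb x f" for y
    unfolding T_delta using Orb_image[OF that] fe_Orb by (intro fs.span_diff fs.span_base imageI)
  then have V_inv: "T u \<in> ?V" if "u \<in> ?V" for u
    by (intro bounded_operator_span_image[OF bT free_subspace _ _ _ that]) (auto simp: delta_in_free)
  have "Orb (delta e x) T \<subseteq> ?V"
    by (rule Orb_minimal) (auto simp: V_inv Orb_self intro: fs.span_base)
  then have "?W \<subseteq> ?V"
    by (intro fs.span_minimal) auto
  with \<open>?V \<subseteq> ?W\<close> show ?thesis by blast
qed

text \<open>In a finite linear combination, each \<open>delta e y\<close> is replaced by
  \<open>delta e z\<close> with \<open>z\<close> in \<open>D\<close> close to
  \<open>y\<close>.\<close>

lemma span_delta_approx_dense:
  fixes G :: "('a::metric_space \<Rightarrow> 'k::real_normed_field) \<Rightarrow> 'k"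
  assumes D: "closure D = UNIV" and G: "G \<in> fs.span (range (delta e))" and \<epsilon>: "\<epsilon> > 0"
  shows "\<exists>H\<in>fs.span (delta e ` D). dual_norm e (G - H) < \<epsilon>"
proof -
  \<comment> \<open>The induction needs every \<epsilon>, since a step spends half of it on the new
    summand, and membership in the dual, on which the triangle inequality for
    \<open>dual_norm\<close> rests.\<close>
  have "G \<in> Lip0_dual e \<and> (\<forall>\<epsilon>>0. \<exists>H\<in>fs.span (delta e ` D). dual_norm e (G - H) < \<epsilon>)"
    using G
  proof (induction rule: fs.span_induct_alt)
    case base
    have "dual_norm e (0 - (0 :: ('a \<Rightarrow> 'k) \<Rightarrow> 'k)) = 0"
      by (simp only: diff_zero dual_norm_zero)
    then show ?case
      using fs.span_zero Lip0_dual_zero by metis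
  next
    case (step c u v)
    obtain y where u: "u = delta e y"
      using step.hyps by blast
    have v_dual: "v \<in> Lip0_dual e"
      using step.IH by blast
    have "\<exists>H\<in>fs.span (delta e ` D). dual_norm e (fscale c u + v - H) < \<epsilon>" if \<epsilon>: "\<epsilon> > 0" for \<epsilon>
    proof -
      have c: "norm c + 1 > 0" by (simp add: add_nonneg_pos)
      obtain H where H: "H \<in> fs.span (delta e ` D)" "dual_norm e (v - H) < \<epsilon> / 2"
        using step.IH half_gt_zero[OF \<epsilon>] by blast
      have "y \<in> closure D" using D by simp
      \<comment> \<open>Replacing \<open>y\<close> by \<open>z\<close> costs at most
        \<open>norm c * dist y z\<close>; the \<open>+ 1\<close> keeps the divisor positive when
        \<open>c = 0\<close>.\<close>
      then obtain z where z: "z \<in> D" "dist z y < \<epsilon> / 2 / (norm c + 1)"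
        using \<epsilon> c unfolding closure_approachable by (meson divide_pos_pos half_gt_zero)
      have H_dual: "H \<in> Lip0_dual e"
        using H(1) fs.span_mono[of "delta e ` D" "range (delta e)"] span_delta_dual by blast
      have uz: "delta e y - delta e z \<in> (Lip0_dual e :: (('a \<Rightarrow> 'k) \<Rightarrow> 'k) set)"
        by (intro Lip0_dual_diff delta_in_dual)
      have "fscale c u + v - (fscale c (delta e z) + H) = fscale c (delta e y - delta e z) + (v - H)"
        by (simp add: u fs.scale_right_diff_distrib)
      then have "dual_norm e (fscale c u + v - (fscale c (delta e z) + H))
          \<le> dual_norm e (fscale c (delta e y - delta e z)) + dual_norm e (v - H)"
        using Lip0_dual_add(2)[OF Lip0_dual_fscale(1)[OF uz, of c] Lip0_dual_diff[OF v_dual H_dual]]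
        by (simp only:)
      also have "dual_norm e (fscale c (delta e y - delta e z)) \<le> norm c * dist y z"
        using Lip0_dual_fscale(2)[OF uz, of c] dual_norm_delta_diff_le[of e y z, where ?'b='k]
        by (meson mult_left_mono norm_ge_zero order_trans)
      also have "norm c * dist y z \<le> (norm c + 1) * dist z y"
        by (simp add: dist_commute mult_right_mono)
      also have "\<dots> < \<epsilon> / 2"
        using z(2) c by (simp add: field_simps)
      finally have "dual_norm e (fscale c u + v - (fscale c (delta e z) + H)) < \<epsilon>"
        using H(2) by linarith
      moreover have "fscale c (delta e z) + H \<in> fs.span (delta e ` D)"
        using H(1) z(1) by (intro fs.span_add[OF fs.span_scale[OF fs.span_base]] imageI)
      ultimately show ?thesis by blast
    qed
    moreover have "fscale c u + v \<in> Lip0_dual e"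
      unfolding u using v_dual by (intro Lip0_dual_add Lip0_dual_fscale delta_in_dual)
    ultimately show ?case by blast
  qed
  with \<epsilon> show ?thesis by blast
qed

lemma norm_closure_span_delta_dense:
  fixes e :: "'a::metric_space"
  assumes D: "closure D = UNIV"
  shows "norm_closure (free_space e) (dual_norm e) (fs.span (delta e ` D)) =
    (free_space e :: (('a \<Rightarrow> 'k::real_normed_field) \<Rightarrow> 'k) set)"
proof -
  have "\<exists>H\<in>fs.span (delta e ` D). dual_norm e (F - H) < \<epsilon>"
    if F: "F \<in> free_space e" and "\<epsilon> > 0" for F :: "('a \<Rightarrow> 'k) \<Rightarrow> 'k" and \<epsilon>
  proof -
    have e2: "\<epsilon> / 2 > 0" using \<open>\<epsilon> > 0\<close> by simp
    obtain G where G: "G \<in> fs.span (range (delta e))" "dual_norm e (F - G) < \<epsilon> / 2"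
      using free_approx[OF F e2] .
    obtain H where H: "H \<in> fs.span (delta e ` D)" "dual_norm e (G - H) < \<epsilon> / 2"
      using span_delta_approx_dense[OF D G(1) e2] by blast
    have dual: "F \<in> Lip0_dual e" "G \<in> Lip0_dual e" "H \<in> Lip0_dual e"
      using F free_subset_dual G(1) H(1) span_delta_dual
        fs.span_mono[of "delta e ` D" "range (delta e)"] by blast+
    have "dual_norm e (F - H) = dual_norm e ((F - G) + (G - H))"
      by (simp only: diff_add_cancel add_diff_eq)
    also have "\<dots> \<le> dual_norm e (F - G) + dual_norm e (G - H)"
      using dual by (intro Lip0_dual_add Lip0_dual_diff)
    also have "\<dots> < \<epsilon>"
      using G(2) H(2) by linarith
    finally show ?thesis
      using H(1) by blast
  qed
  \<comment> \<open>\<open>norm_closure\<close> is cut down to its carrier by definition, so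
    approximability of each vector of \<open>free_space e\<close> is all that equality
    requires.\<close>
  then show ?thesis
    unfolding norm_closure_def by blast
qed

text \<open>Evaluation at \<phi> is linear and, by \<open>dual_norm_bound\<close>, continuous for
  \<open>dual_norm e\<close>, so its kernel is a closed subspace.\<close>

lemma norm_closure_annihilator:
  fixes \<phi> :: "'a::metric_space \<Rightarrow> 'k::real_normed_field"
  assumes F: "F \<in> norm_closure X (dual_norm e) (fs.span S)" and "X \<subseteq> Lip0_dual e" "S \<subseteq> Lip0_dual e"
    and \<phi>: "\<phi> \<in> Lip0 e" and S: "\<And>G. G \<in> S \<Longrightarrow> G \<phi> = 0"
  shows "F \<phi> = 0"
proof -
  have span_S: "fs.span S \<subseteq> {G \<in> Lip0_dual e. G \<phi> = 0}"
  proof (rule fs.span_minimal)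
    show "S \<subseteq> {G \<in> Lip0_dual e. G \<phi> = 0}" using assms by blast
    show "fs.subspace {G \<in> Lip0_dual e. G \<phi> = 0}"
      by (rule fs.subspaceI) (auto simp: Lip0_dual_zero Lip0_dual_add Lip0_dual_fscale, simp add: fscale_def)
  qed
  have F_dual: "F \<in> Lip0_dual e"
    using F \<open>X \<subseteq> Lip0_dual e\<close> by (auto simp: norm_closure_def)
  have "norm (F \<phi>) \<le> 0 + \<epsilon>" if "\<epsilon> > 0" for \<epsilon>
  proof -
    have l: "lip_norm \<phi> + 1 > 0" using lip_norm_nonneg[OF \<phi>] by simp
    then obtain G where G: "G \<in> fs.span S" "dual_norm e (F - G) < \<epsilon> / (lip_norm \<phi> + 1)"
      using F \<open>\<epsilon> > 0\<close> unfolding norm_closure_def by (auto dest!: spec[of _ "\<epsilon> / (lip_norm \<phi> + 1)"])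
    have G': "G \<in> Lip0_dual e" "G \<phi> = 0" using G(1) span_S by auto
    have D: "F - G \<in> Lip0_dual e" using F_dual G' by (intro Lip0_dual_diff)
    have "norm (F \<phi>) = norm ((F - G) \<phi>)" using G' by simp
    also have "\<dots> \<le> dual_norm e (F - G) * lip_norm \<phi>" by (rule dual_norm_bound[OF D \<phi>])
    also have "\<dots> \<le> dual_norm e (F - G) * (lip_norm \<phi> + 1)"
      by (rule mult_left_mono) (use dual_norm_nonneg[OF D] in auto)
    also have "\<dots> \<le> \<epsilon>" using G(2) l by (simp add: field_simps)
    finally show ?thesis by simp
  qed
  then have "norm (F \<phi>) \<le> 0" by (rule field_le_epsilon)
  then show ?thesis by simp
qed

text \<open>Truncation at 0 and the distance to \<open>y\<close> are both nonexpansive, which gives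
  the constant 1. The assumption on \<open>r\<close> puts \<open>e\<close> outside the open ball, so
  the bump vanishes there.\<close>

lemma bump_in_Lip0:
  fixes y :: "'a::metric_space"
  assumes "r \<le> dist e y"
  shows "(\<lambda>z. of_real (max 0 (r - dist z y)) :: 'k::real_normed_field) \<in> Lip0 e"
proof (rule Lip0I(1)[where C = 1])
  fix u v :: 'a
  have "\<bar>max 0 (r - dist u y) - max 0 (r - dist v y)\<bar> \<le> dist u v"
    using dist_triangle[of u y v] dist_triangle[of v y u] by (auto simp: dist_commute)
  then show "norm (of_real (max 0 (r - dist u y)) - of_real (max 0 (r - dist v y)) :: 'k) \<le> 1 * dist u v"
    by (simp only: of_real_diff[symmetric] norm_of_real mult_1)
qed (use assms in auto)

lemma dense_if_norm_closure_span_delta: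
  fixes e :: "'a::metric_space"
  assumes "e \<in> D"
    and cl: "norm_closure (free_space e) (dual_norm e) (fs.span (delta e ` D)) =
      (free_space e :: (('a \<Rightarrow> 'k::real_normed_field) \<Rightarrow> 'k) set)"
  shows "closure D = UNIV"
proof (rule ccontr)
  assume "closure D \<noteq> UNIV"
  then obtain y where "y \<notin> closure D" by blast
  then obtain r where r: "r > 0" "\<And>z. z \<in> D \<Longrightarrow> r \<le> dist z y"
    unfolding closure_approachable by (meson not_le)
  \<comment> \<open>This \<phi> is 0 on \<open>D\<close>, hence at \<open>e\<close>, while its value
    at \<open>y\<close> is \<open>r > 0\<close>.\<close>
  define \<phi> :: "'a \<Rightarrow> 'k" where "\<phi> = (\<lambda>z. of_real (max 0 (r - dist z y)))"
  have \<phi>: "\<phi> \<in> Lip0 e"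
    unfolding \<phi>_def using assms(1) by (intro bump_in_Lip0 r)
  have "delta e y \<in> norm_closure (free_space e) (dual_norm e)
      (fs.span (delta e ` D) :: (('a \<Rightarrow> 'k) \<Rightarrow> 'k) set)"
    unfolding cl by (rule delta_in_free)
  then have "delta e y \<phi> = 0"
  proof (rule norm_closure_annihilator[OF _ free_subset_dual _ \<phi>])
    show "G \<phi> = 0" if "G \<in> delta e ` D" for G
      using that r(2) by (auto simp: delta_def \<phi>_def)
  qed (auto simp: delta_in_dual)
  then show False
    using r(1) \<phi> by (simp add: delta_def) (simp add: \<phi>_def)
qed

lemma dense_Orb_iff_cyclic_vector:
  fixes f :: "'a::metric_space \<Rightarrow> 'a"
  assumes "L-lipschitz_on UNIV f" and e: "e = f x"
  shows "closure (Orb x f) = UNIV \<longleftrightarrow>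
    cyclic_vector fscale (free_space e) (dual_norm e) (free_op f e)
      (delta e x :: ('a \<Rightarrow> 'k::real_normed_field) \<Rightarrow> 'k)"
proof -
  \<comment> \<open>Only because the base point lies on the orbit does the bump built from a missed
    ball belong to \<open>Lip0 e\<close>.\<close>
  have "e \<in> Orb x f"
    by (simp add: e Orb_image Orb_self)
  then have "closure (Orb x f) = UNIV \<longleftrightarrow>
      norm_closure (free_space e) (dual_norm e) (fs.span (delta e ` Orb x f)) =
        (free_space e :: (('a \<Rightarrow> 'k) \<Rightarrow> 'k) set)"
    by (metis norm_closure_span_delta_dense dense_if_norm_closure_span_delta)
  then show ?thesis
    unfolding cyclic_vector_def span_Orb_free_op[OF is_free_op_free_op[OF assms(1)] e]
    by (simp only: delta_in_free simp_thms)
qed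

theorem proposition5p4:
  fixes f :: "'a::metric_space \<Rightarrow> 'a" and x e :: 'a
  assumes "\<exists>L. L-lipschitz_on UNIV f"
    and "e = f x"
  shows "(closure (Orb x f) = UNIV \<longleftrightarrow>
      cyclic_vector fscale (free_space e) (dual_norm e) (free_op f e)
        (delta e x :: ('a \<Rightarrow> real) \<Rightarrow> real)) \<and>
    (closure (Orb x f) = UNIV \<longleftrightarrow>
      cyclic_vector fscale (free_space e) (dual_norm e) (free_op f e)
        (delta e x :: ('a \<Rightarrow> complex) \<Rightarrow> complex))"
proof -
  obtain L where L: "L-lipschitz_on UNIV f"
    using assms(1) by blast
  show ?thesis
    by (intro conjI dense_Orb_iff_cyclic_vector[OF L assms(2)])
qed

end
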